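(* Let $x^\ast\in\mathcal{C}$, the feasible region of the MPVC. If $x^\ast$ is MPVC-generalized quasinormal, then there are $\delta,c>0$ such that $$\mathrm{dist}_{\mathcal{C}}(x)\le c\left(\|h(x)\|_1+\|g^+(x)\|_1+\sum_{i=1}^q\mathrm{dist}_\Delta(G_i(x),H_i(x))\right)$$ holds for all $x\in\mathbb{B}(x^\ast,\delta/2)$, where $\Delta:=\{(a,b)\in\mathbb{R}^2: b\ge0,\ ab\le0\}$ and $\mathrm{dist}_\Delta(\cdot)$ is the distance in the $\ell_1$-norm to the set $\Delta$.
   Context: The mathematical program with vanishing constraints (MPVC) is: minimize $f(x)$ over $x\in\mathbb{R}^n$ subject to $g_i(x)\le 0$ ($i=1,\dots,m$), $h_i(x)=0$ ($i=1,\dots,p$), $H_i(x)\ge 0$ and $G_i(x)H_i(x)\le 0$ ($i=1,\dots,q$), where all functions $f,g_i,h_i,G_i,H_i:\mathbb{R}^n\to\mathbb{R}$ are continuously differentiable. Let $\mathcal{C}$ be its feasible set, $g=(g_1,\dots,g_m)$, $h=(h_1,\dots,h_p)$, and $g^+(x)=\max\{0,g(x)\}$ componentwise. $\mathrm{dist}_{\mathcal{C}}(x)$ is the Euclidean distance from $x$ to $\mathcal{C}$, $\|\cdot\|_1$ is the $\ell_1$-norm, and $\mathbb{B}(x^\ast,r)$ is the ball of radius $r$ about $x^\ast$. For $x^\ast\in\mathcal{C}$ put $I_g=\{i: g_i(x^\ast)=0\}$, $I_+=\{i:H_i(x^\ast)>0\}$, $I_{+0}=\{i:H_i(x^\ast)>0,G_i(x^\ast)=0\}$,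 $I_{+-}=\{i:H_i(x^\ast)>0,G_i(x^\ast)<0\}$, $I_{00}=\{i:H_i(x^\ast)=0,G_i(x^\ast)=0\}$, $I_{0+}=\{i:H_i(x^\ast)=0,G_i(x^\ast)>0\}$, $I_{0-}=\{i:H_i(x^\ast)=0,G_i(x^\ast)<0\}$. $x^\ast\in\mathcal{C}$ is MPVC-generalized quasinormal if there is no nonzero $(\lambda,\mu,\eta^G,\eta^H)\in\mathbb{R}^m\times\mathbb{R}^p\times\mathbb{R}^q\times\mathbb{R}^q$ such that: (i) $\sum_{i=1}^m\lambda_i\nabla g_i(x^\ast)+\sum_{i=1}^p\mu_i\nabla h_i(x^\ast)+\sum_{i=1}^q\eta_i^G\nabla G_i(x^\ast)-\sum_{i=1}^q\eta_i^H\nabla H_i(x^\ast)=0$; (ii) $\lambda_i\ge0$ for $i\in I_g$, $\lambda_i=0$ for $i\notin I_g$; $\eta_i^G=0$ for $i\in I_{+-}\cup I_{0-}\cup I_{0+}$, $\eta_i^G\ge0$ for $i\in I_{+0}\cup I_{00}$; $\eta_i^H=0$ for $i\in I_+$, $\eta_i^H\ge0$ for $i\in I_{0-}$, $\eta_i^H$ free for $i\in I_{0+}$; $\eta_i^H\eta_i^G=0$ for $i\in I_{00}$; (iii) there is a sequence $x^k\to x^\ast$ in $\mathbb{R}^n$ such that for all $k\in\mathbb{N}$: $\lambda_i>0\Rightarrow\lambda_ig_i(x^k)>0$ ($i=1,\dots,m$); $\mu_i\ne0\Rightarrow\mu_ih_i(x^k)>0$ ($i=1,\dots,p$); $\eta_i^H\ne0\Rightarrow\eta_i^HH_i(x^k)<0$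 ($i=1,\dots,q$); $\eta_i^G>0\Rightarrow\eta_i^GG_i(x^k)>0$ ($i=1,\dots,q$). *)

theory Defs
  imports "HOL-Analysis.Analysis"
begin

text \<open>
  The constraint families are functions \<open>nat \<Rightarrow> real ^ 'n \<Rightarrow> real\<close> read only at the
  indices \<open>{1..m}\<close>, \<open>{1..p}\<close>, \<open>{1..q}\<close>, so that each of the numbers \<open>m\<close>, \<open>p\<close>, \<open>q\<close> may be \<open>0\<close>.
  Multipliers are treated in the same way: their values at other indices play no role.
\<close>

definition gradient :: "(real ^ 'n \<Rightarrow> real) \<Rightarrow> real ^ 'n \<Rightarrow> real ^ 'n" where
  "gradient f x = (THE D. GDERIV f x :> D)"

lemma gradient_eqI:
  assumes "GDERIV f x :> D"
  shows "gradient f x = D"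
  unfolding gradient_def
proof (rule the_equality)
  fix E assume "GDERIV f x :> E"
  then have "(\<lambda>h. h \<bullet> E) = (\<lambda>h. h \<bullet> D)"
    using assms unfolding gderiv_def by (rule has_derivative_unique)
  then have "h \<bullet> E = h \<bullet> D" for h
    by (rule fun_cong)
  then show "E = D"
    using vector_eq_ldot[of E D] by simp
qed (fact assms)

definition continuously_differentiable :: "(real ^ 'n \<Rightarrow> real) \<Rightarrow> bool" where
  "continuously_differentiable f \<longleftrightarrow>
     (\<forall>x. f differentiable (at x)) \<and> continuous_on UNIV (gradient f)"

definition mpvc_feasible ::
  "nat \<Rightarrow> nat \<Rightarrow> nat \<Rightarrow>
   (nat \<Rightarrow> real ^ 'n \<Rightarrow> real) \<Rightarrow> (nat \<Rightarrow> real ^ 'n \<Rightarrow> real) \<Rightarrow>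
   (nat \<Rightarrow> real ^ 'n \<Rightarrow> real) \<Rightarrow> (nat \<Rightarrow> real ^ 'n \<Rightarrow> real) \<Rightarrow> (real ^ 'n) set" where
  "mpvc_feasible m p q g h G H =
     {x. (\<forall>i\<in>{1..m}. g i x \<le> 0) \<and> (\<forall>i\<in>{1..p}. h i x = 0) \<and>
         (\<forall>i\<in>{1..q}. H i x \<ge> 0 \<and> G i x * H i x \<le> 0)}"

context
  fixes q :: nat and G H :: "nat \<Rightarrow> real ^ 'n \<Rightarrow> real" and x :: "real ^ 'n"
begin

definition I_pos :: "nat set" where
  "I_pos = {i\<in>{1..q}. H i x > 0}"

definition I_pos_zero :: "nat set" where
  "I_pos_zero = {i\<in>{1..q}. H i x > 0 \<and> G i x = 0}"

definition I_pos_neg :: "nat set" where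
  "I_pos_neg = {i\<in>{1..q}. H i x > 0 \<and> G i x < 0}"

definition I_zero_zero :: "nat set" where
  "I_zero_zero = {i\<in>{1..q}. H i x = 0 \<and> G i x = 0}"

definition I_zero_pos :: "nat set" where
  "I_zero_pos = {i\<in>{1..q}. H i x = 0 \<and> G i x > 0}"

definition I_zero_neg :: "nat set" where
  "I_zero_neg = {i\<in>{1..q}. H i x = 0 \<and> G i x < 0}"

end

definition I_active :: "nat \<Rightarrow> (nat \<Rightarrow> real ^ 'n \<Rightarrow> real) \<Rightarrow> real ^ 'n \<Rightarrow> nat set" where
  "I_active m g x = {i\<in>{1..m}. g i x = 0}"

definition mpvc_generalized_quasinormal ::
  "nat \<Rightarrow> nat \<Rightarrow> nat \<Rightarrow>
   (nat \<Rightarrow> real ^ 'n \<Rightarrow> real) \<Rightarrow> (nat \<Rightarrow> real ^ 'n \<Rightarrow> real) \<Rightarrow>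
   (nat \<Rightarrow> real ^ 'n \<Rightarrow> real) \<Rightarrow> (nat \<Rightarrow> real ^ 'n \<Rightarrow> real) \<Rightarrow> real ^ 'n \<Rightarrow> bool" where
  "mpvc_generalized_quasinormal m p q g h G H x \<longleftrightarrow>
     \<not> (\<exists>(lam :: nat \<Rightarrow> real) (mu :: nat \<Rightarrow> real) (etaG :: nat \<Rightarrow> real) (etaH :: nat \<Rightarrow> real).
       ((\<exists>i\<in>{1..m}. lam i \<noteq> 0) \<or> (\<exists>i\<in>{1..p}. mu i \<noteq> 0) \<or>
        (\<exists>i\<in>{1..q}. etaG i \<noteq> 0) \<or> (\<exists>i\<in>{1..q}. etaH i \<noteq> 0)) \<and>
       (\<Sum>i=1..m. lam i *\<^sub>R gradient (g i) x) + (\<Sum>i=1..p. mu i *\<^sub>R gradient (h i) x)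
         + (\<Sum>i=1..q. etaG i *\<^sub>R gradient (G i) x)
         - (\<Sum>i=1..q. etaH i *\<^sub>R gradient (H i) x) = 0 \<and>
       (\<forall>i\<in>I_active m g x. lam i \<ge> 0) \<and>
       (\<forall>i\<in>{1..m} - I_active m g x. lam i = 0) \<and>
       (\<forall>i\<in>I_pos_neg q G H x \<union> I_zero_neg q G H x \<union> I_zero_pos q G H x. etaG i = 0) \<and>
       (\<forall>i\<in>I_pos_zero q G H x \<union> I_zero_zero q G H x. etaG i \<ge> 0) \<and>
       (\<forall>i\<in>I_pos q H x. etaH i = 0) \<and>
       (\<forall>i\<in>I_zero_neg q G H x. etaH i \<ge> 0) \<and>
       (\<forall>i\<in>I_zero_zero q G H x. etaH i * etaG i = 0) \<and>
       (\<exists>X :: nat \<Rightarrow> real ^ 'n. X \<longlonglongrightarrow> x \<and>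
         (\<forall>k.
           (\<forall>i\<in>{1..m}. lam i > 0 \<longrightarrow> lam i * g i (X k) > 0) \<and>
           (\<forall>i\<in>{1..p}. mu i \<noteq> 0 \<longrightarrow> mu i * h i (X k) > 0) \<and>
           (\<forall>i\<in>{1..q}. etaH i \<noteq> 0 \<longrightarrow> etaH i * H i (X k) < 0) \<and>
           (\<forall>i\<in>{1..q}. etaG i > 0 \<longrightarrow> etaG i * G i (X k) > 0))))"

definition l1_norm :: "nat \<Rightarrow> (nat \<Rightarrow> real) \<Rightarrow> real" where
  "l1_norm d v = (\<Sum>i=1..d. \<bar>v i\<bar>)"

definition Delta :: "(real \<times> real) set" where
  "Delta = {(a, b). b \<ge> 0 \<and> a * b \<le> 0}"

text \<open>
  The library distance on \<open>real \<times> real\<close> (and hence \<^const>\<open>infdist\<close>) is Euclidean;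
  here the \<open>\<ell>\<^sub>1\<close>-distance is required.
\<close>

definition dist_Delta :: "real \<times> real \<Rightarrow> real" where
  "dist_Delta z = (INF w\<in>Delta. \<bar>fst z - fst w\<bar> + \<bar>snd z - snd w\<bar>)"

end

theory Submission
  imports Defs
begin

text \<open>
  Measure infeasibility by the Euclidean norm \<open>\<psi>\<close> of the residuals \<open>g\<^sub>i\<^sup>+\<close>, \<open>h\<^sub>i\<close> and
  \<open>dist\<^sub>\<Delta>(G\<^sub>i, H\<^sub>i)\<close>, which is dominated by their sum. If no bound
  \<open>dist\<^sub>\<C> \<le> c \<psi>\<close> holds near \<open>x\<^sup>*\<close>, minimizing \<open>\<psi> + \<epsilon> \<parallel>\<sqdot> - x\<parallel>\<close> over suitable balls yields
  infeasible points \<open>y \<rightarrow> x\<^sup>*\<close> at which \<open>\<psi> + \<epsilon> \<parallel>\<sqdot> - y\<parallel>\<close> has a local minimum, with \<open>\<epsilon> \<rightarrow> 0\<close>.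
  Off the feasible set the Euclidean norm is smooth in the residuals, and its derivative
  weights the constraint gradients by residual divided by \<open>\<psi>(y)\<close>: a unit vector of multipliers in which
  every nonzero entry belongs to a constraint violated at \<open>y\<close>. (The \<open>\<ell>\<^sub>1\<close>-norm would leave the
  multipliers of constraints with residual \<open>0\<close> undetermined.) A cluster point of these multipliers
  contradicts generalized quasinormality.
\<close>

section \<open>Calculus of gradients and of the squared positive part\<close>

text \<open>Moving from \<open>y\<close> in the direction \<open>- D\<close> changes
  \<open>\<phi>\<close> at the rate \<open>- (D \<bullet> D)\<close>, while the hypothesis allows a
  decrease at a rate of at most \<open>\<epsilon> * norm D\<close>.\<close>

lemma GDERIV_norm_le_if_calm:
  fixes \<phi> :: "'a::real_inner \<Rightarrow> real"
  assumes der: "GDERIV \<phi> y :> D" and \<epsilon>: "0 \<le> \<epsilon>"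
    and le: "\<forall>\<^sub>F x in nhds y. \<phi> y \<le> \<phi> x + \<epsilon> * dist x y"
  shows "norm D \<le> \<epsilon>"
proof (cases "D = 0")
  case False
  have "((\<lambda>t::real. y + t *\<^sub>R (- D)) has_derivative (\<lambda>t. t *\<^sub>R (- D))) (at 0)"
    by (auto intro!: derivative_eq_intros)
  then have "((\<lambda>t. \<phi> (y + t *\<^sub>R (- D))) has_derivative (\<lambda>t. (t *\<^sub>R (- D)) \<bullet> D)) (at 0)"
    using has_derivative_compose[of "\<lambda>t::real. y + t *\<^sub>R (- D)"] der
    unfolding gderiv_def by fastforce
  then have "DERIV (\<lambda>t. \<phi> (y + t *\<^sub>R (- D))) 0 :> - (D \<bullet> D)"
    unfolding has_field_derivative_def by (rule has_derivative_eq_rhs) (auto simp: mult.commute)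
  then have "((\<lambda>t. (\<phi> (y + t *\<^sub>R (- D)) - \<phi> y) / t) \<longlongrightarrow> - (D \<bullet> D)) (at_right 0)"
    unfolding DERIV_def by (auto intro: tendsto_mono[OF at_le])
  moreover
  have "((\<lambda>t::real. y + t *\<^sub>R (- D)) \<longlongrightarrow> y + 0 *\<^sub>R (- D)) (at_right 0)"
    by (intro tendsto_intros)
  then have "\<forall>\<^sub>F t in at_right 0. \<phi> y \<le> \<phi> (y + t *\<^sub>R (- D)) + \<epsilon> * norm (t *\<^sub>R (- D))"
    using eventually_compose_filterlim[OF le, of "\<lambda>t. y + t *\<^sub>R (- D)"]
    by (simp add: dist_norm)
  then have "\<forall>\<^sub>F t in at_right 0. - (\<epsilon> * norm D) \<le> (\<phi> (y + t *\<^sub>R (- D)) - \<phi> y) / t"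
    using eventually_at_right_less[of "0::real"]
    by eventually_elim (auto simp: field_simps)
  ultimately have "- (\<epsilon> * norm D) \<le> - (D \<bullet> D)"
    by (intro tendsto_lowerbound) auto
  then have "norm D * norm D \<le> \<epsilon> * norm D"
    by (simp add: dot_square_norm power2_eq_square)
  then show ?thesis
    using False by (metis mult_le_cancel_right norm_le_zero_iff not_less zero_less_norm_iff)
qed (use \<epsilon> in simp)

text \<open>Squaring smooths the kink of the positive part: at 0 the difference quotient is bounded
  by \<open>\<bar>s\<bar>\<close>.\<close>

lemma DERIV_pos_part_square: "DERIV (\<lambda>t::real. (max 0 t)\<^sup>2) t :> 2 * max 0 t"
proof -
  consider "t > 0" | "t < 0" | "t = 0" by linarith
  then show ?thesis
  proof cases
    case 1
    then have "\<forall>\<^sub>F s in nhds t. (max 0 s)\<^sup>2 = s\<^sup>2"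
      using eventually_nhds_in_open[of "{0<..}" t] by (auto elim: eventually_mono)
    moreover have "DERIV (\<lambda>s. s\<^sup>2) t :> 2 * max 0 t"
      using 1 by (auto intro!: derivative_eq_intros)
    ultimately show ?thesis by (subst DERIV_cong_ev) auto
  next
    case 2
    then have "\<forall>\<^sub>F s in nhds t. (max 0 s)\<^sup>2 = 0"
      using eventually_nhds_in_open[of "{..<0}" t] by (auto elim: eventually_mono)
    moreover have "DERIV (\<lambda>s::real. 0::real) t :> 2 * max 0 t"
      using 2 by (auto intro!: derivative_eq_intros)
    ultimately show ?thesis by (subst DERIV_cong_ev) auto
  next
    case 3
    have "((\<lambda>s::real. (max 0 s)\<^sup>2 / s) \<longlongrightarrow> 0) (at 0)"
    proof (rule Lim_null_comparison)
      show "\<forall>\<^sub>F s in at 0. norm ((max 0 s)\<^sup>2 / s) \<le> norm (s::real)"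
        by (intro always_eventually) (auto simp: max_def power2_eq_square)
      show "((\<lambda>s::real. norm s) \<longlongrightarrow> 0) (at 0)"
        by (intro tendsto_eq_intros) auto
    qed
    then show ?thesis using 3 by (simp add: DERIV_def)
  qed
qed

text \<open>The derivative is a linear functional; its adjoint applied to 1 is the vector
  representing it, so the description in \<open>gradient\<close> denotes.\<close>

lemma GDERIV_gradient:
  fixes f :: "real ^ 'n \<Rightarrow> real"
  assumes "f differentiable (at x)"
  shows "GDERIV f x :> gradient f x"
proof -
  obtain f' where f': "(f has_derivative f') (at x)"
    using assms unfolding differentiable_def by blast
  interpret linear f' using f' by (rule has_derivative_linear)
  have "f' v = v \<bullet> adjoint f' 1" for v
    using adjoint_works[OF linear_axioms, of v 1] by simp
  then have "f' = (\<lambda>v. v \<bullet> adjoint f' 1)" ..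
  with f' have "GDERIV f x :> adjoint f' 1"
    by (simp add: gderiv_def)
  then show ?thesis using gradient_eqI by metis
qed

section \<open>Closed form of the distance to \<open>Delta\<close>\<close>

text \<open>\<open>Delta\<close> is the union of the axis \<open>b = 0\<close> and the quadrant
  \<open>a \<le> 0 \<le> b\<close>. Below the axis the distance is \<open>- b\<close>; in the open
  positive quadrant it is the shorter way to one of the two pieces.\<close>

lemma dist_Delta_eq: "dist_Delta (a, b) = max 0 (max (- b) (min a b))"
proof -
  have bdd: "bdd_below ((\<lambda>w. \<bar>a - fst w\<bar> + \<bar>b - snd w\<bar>) ` Delta)"
    by (rule bdd_belowI[of _ 0]) auto
  have lower: "max 0 (max (- b) (min a b)) \<le> \<bar>a - fst w\<bar> + \<bar>b - snd w\<bar>" if "w \<in> Delta" for w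
    using that by (cases w) (auto simp: Delta_def mult_le_0_iff)
  \<comment> \<open>If \<open>0 < b\<close> and \<open>a \<le> b\<close>, a nearest point is reached
    horizontally, otherwise vertically on the axis.\<close>
  have "\<exists>w\<in>Delta. \<bar>a - fst w\<bar> + \<bar>b - snd w\<bar> = max 0 (max (- b) (min a b))"
  proof (cases "0 < b \<and> a \<le> b")
    case True
    then show ?thesis
      by (intro bexI[of _ "(min a 0, b)"]) (auto simp: Delta_def mult_le_0_iff)
  next
    case False
    then show ?thesis
      by (intro bexI[of _ "(a, 0)"]) (auto simp: Delta_def)
  qed
  then show ?thesis
    unfolding dist_Delta_def fst_conv snd_conv
    by (metis (no_types, lifting) cINF_greatest cINF_lower[OF bdd] lower order_antisym emptyE)
qed

lemma dist_Delta_eq_0_iff: "dist_Delta (a, b) = 0 \<longleftrightarrow> b \<ge> 0 \<and> a * b \<le> 0"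
  by (auto simp: dist_Delta_eq max_def min_def mult_le_0_iff split: if_splits)

section \<open>Compactness and an abstract error bound\<close>

text \<open>Bolzano-Weierstrass, refining the subsequence once per index. The arbitrary index type
  allows several families of multipliers to be treated at once.\<close>

lemma finite_family_convergent_subseq:
  fixes u :: "nat \<Rightarrow> 'i \<Rightarrow> real"
  assumes "finite J" and "\<And>j k. j \<in> J \<Longrightarrow> \<bar>u k j\<bar> \<le> B"
  shows "\<exists>l r. strict_mono (r :: nat \<Rightarrow> nat) \<and> (\<forall>j\<in>J. (\<lambda>k. u (r k) j) \<longlonglongrightarrow> l j)"
  using assms
proof (induction J rule: finite_induct)
  case empty
  show ?case by (auto intro: strict_mono_id[unfolded id_def])
next
  case (insert i J)
  then have "\<exists>l r. strict_mono (r :: nat \<Rightarrow> nat) \<and> (\<forall>j\<in>J. (\<lambda>k. u (r k) j) \<longlonglongrightarrow> l j)"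
    by simp
  then obtain l r where r: "strict_mono (r :: nat \<Rightarrow> nat)"
    and l: "\<And>j. j \<in> J \<Longrightarrow> (\<lambda>k. u (r k) j) \<longlonglongrightarrow> l j"
    by blast
  have "bounded (range (\<lambda>k. u (r k) i))"
    unfolding bounded_iff using insert.prems by auto
  then obtain a s where s: "strict_mono (s :: nat \<Rightarrow> nat)" and a: "((\<lambda>k. u (r k) i) \<circ> s) \<longlonglongrightarrow> a"
    using bounded_imp_convergent_subsequence by blast
  have "(\<lambda>k. u (r (s k)) j) \<longlonglongrightarrow> (l(i := a)) j" if "j \<in> insert i J" for j
    using that a LIMSEQ_subseq_LIMSEQ[OF l s] insert.hyps by (cases "j = i") (auto simp: o_def)
  then show ?case
    using strict_mono_o[OF r s] by (intro exI[of _ "l(i := a)"] exI[of _ "r \<circ> s"]) (simp add: o_def)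
qed

text \<open>An Ekeland-type argument, with compact balls supplying the minimizer. If the bound
  failed at \<open>x\<close>, a minimizer of \<open>\<psi> z + \<epsilon> * dist z x\<close> over
  the closed ball of radius \<open>d\<close> about \<open>x\<close> would lie within
  \<open>d / 2\<close> of \<open>x\<close>. It is then interior, is not a zero of
  \<open>\<psi>\<close>, and is a point of the kind that \<open>none\<close> excludes.\<close>

lemma error_bound_if_no_calm_point:
  fixes \<psi> :: "'a::heine_borel \<Rightarrow> real"
  assumes cont: "continuous_on UNIV \<psi>" and nonneg: "\<And>x. 0 \<le> \<psi> x"
    and xs: "\<psi> xs = 0" and "0 < \<epsilon>"
    and none: "\<And>y. y \<in> ball xs \<delta> \<Longrightarrow> 0 < \<psi> y \<Longrightarrow>
      \<not> (\<forall>\<^sub>F x in nhds y. \<psi> y \<le> \<psi> x + \<epsilon> * dist x y)"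
    and x: "x \<in> ball xs (\<delta> / 2)"
  shows "infdist x {x. \<psi> x = 0} \<le> 2 / \<epsilon> * \<psi> x"
proof (rule ccontr)
  define d where "d = infdist x {x. \<psi> x = 0}"
  assume "\<not> ?thesis"
  then have d: "\<psi> x < \<epsilon> * d / 2"
    using \<open>0 < \<epsilon>\<close> by (simp add: d_def field_simps)
  then have "0 < \<epsilon> * d"
    using nonneg[of x] by linarith
  then have "0 < d"
    using \<open>0 < \<epsilon>\<close> by (simp add: zero_less_mult_iff)
  have "continuous_on (cball x d) (\<lambda>z. \<psi> z + \<epsilon> * dist z x)"
    by (intro continuous_intros continuous_on_subset[OF cont]) auto
  then have "\<exists>y\<in>cball x d. \<forall>z\<in>cball x d. \<psi> y + \<epsilon> * dist y x \<le> \<psi> z + \<epsilon> * dist z x"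
    using \<open>0 < d\<close> by (intro continuous_attains_inf compact_cball) auto
  then obtain y
    where min: "\<And>z. z \<in> cball x d \<Longrightarrow> \<psi> y + \<epsilon> * dist y x \<le> \<psi> z + \<epsilon> * dist z x"
    by blast
  have "\<psi> y + \<epsilon> * dist y x \<le> \<psi> x"
    using min[of x] \<open>0 < d\<close> by simp
  then have "\<epsilon> * dist y x < \<epsilon> * (d / 2)"
    using d nonneg[of y] by simp
  then have yx: "dist y x < d / 2"
    using \<open>0 < \<epsilon>\<close> by simp
  have "d \<le> dist x y" if "\<psi> y = 0"
    unfolding d_def using that by (intro infdist_le) simp
  then have "0 < \<psi> y"
    using nonneg[of y] yx \<open>0 < d\<close> by (fastforce simp: dist_commute less_le)
  \<comment> \<open>Since \<open>xs\<close> is a zero, \<open>d < \<delta> / 2\<close>; passing from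
    \<open>x\<close> to \<open>y\<close> costs less than \<open>\<delta> / 4\<close> and stays in
    the ball about \<open>xs\<close>.\<close>
  moreover have "d \<le> dist x xs"
    unfolding d_def using xs by (intro infdist_le) simp
  then have "y \<in> ball xs \<delta>"
    using x yx \<open>0 < d\<close> dist_triangle[of xs y x] by (simp add: dist_commute)
  moreover have "\<forall>\<^sub>F z in nhds y. z \<in> ball x d"
    using yx \<open>0 < d\<close> by (intro eventually_nhds_in_open) (auto simp: dist_commute)
  then have "\<forall>\<^sub>F z in nhds y. \<psi> y \<le> \<psi> z + \<epsilon> * dist z y"
  proof eventually_elim
    case (elim z)
    \<comment> \<open>The triangle inequality moves the centre of the penalty from \<open>x\<close>
      to \<open>y\<close>.\<close>
    have "\<epsilon> * dist z x \<le> \<epsilon> * (dist z y + dist y x)"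
      using \<open>0 < \<epsilon>\<close> by (intro mult_left_mono dist_triangle) auto
    then show ?case
      using min[of z] elim by (simp add: algebra_simps)
  qed
  ultimately show False using none by blast
qed


section \<open>Squared residuals and smooth majorants of the squared distance\<close>

lemma GDERIV_sum:
  assumes "\<And>i. i \<in> I \<Longrightarrow> GDERIV (f i) x :> D i"
  shows "GDERIV (\<lambda>x. \<Sum>i\<in>I. f i x) x :> (\<Sum>i\<in>I. D i)"
  using assms unfolding gderiv_def inner_sum_right by (rule has_derivative_sum)

lemma GDERIV_square:
  assumes "GDERIV f x :> D"
  shows "GDERIV (\<lambda>x. (f x)\<^sup>2) x :> 2 *\<^sub>R (f x *\<^sub>R D)"
proof -
  have "DERIV (\<lambda>t. t\<^sup>2) (f x) :> 2 * f x"
    by (auto intro!: derivative_eq_intros)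
  from GDERIV_DERIV_compose[OF assms this] show ?thesis by simp
qed

lemma GDERIV_pos_part_square:
  assumes "GDERIV f x :> D"
  shows "GDERIV (\<lambda>x. (max 0 (f x))\<^sup>2) x :> 2 *\<^sub>R (max 0 (f x) *\<^sub>R D)"
  using GDERIV_DERIV_compose[OF assms DERIV_pos_part_square] by simp

text \<open>
  The squared distance to \<open>\<Delta>\<close> has kinks on the ray \<open>0 < a = b\<close>. Near a given point it is
  bounded above by the square of \<open>a\<^sup>+\<close> or of \<open>b\<close>, whichever branch of \<open>\<Delta>\<close> is closer there,
  with equality at the point itself.
\<close>

lemma dist_Delta_square_model:
  fixes G H :: "'a::real_inner \<Rightarrow> real"
  assumes G: "GDERIV G y :> DG" and H: "GDERIV H y :> DH"
  shows "\<exists>\<phi> a b. GDERIV \<phi> y :> 2 *\<^sub>R (a *\<^sub>R DG - b *\<^sub>R DH) \<and>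
    \<phi> y = a\<^sup>2 + b\<^sup>2 \<and> a\<^sup>2 + b\<^sup>2 = (dist_Delta (G y, H y))\<^sup>2 \<and>
    (\<forall>\<^sub>F x in nhds y. (dist_Delta (G x, H x))\<^sup>2 \<le> \<phi> x) \<and>
    0 \<le> a \<and> a * b = 0 \<and> (a \<noteq> 0 \<longrightarrow> 0 < G y \<and> G y \<le> H y) \<and>
    (b \<noteq> 0 \<longrightarrow> b * H y < 0 \<and> (H y < 0 \<or> H y < G y))"
proof (cases "0 < H y \<and> G y \<le> H y")
  case True
  have "isCont H y"
    using H unfolding gderiv_def by (rule has_derivative_continuous)
  \<comment> \<open>The distance is bounded by the positive part of \<open>a\<close> only where
    \<open>b\<close> is not too negative, so this majorant is merely local.\<close>
  then have "\<forall>\<^sub>F x in nhds y. 0 < H x"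
    using True unfolding continuous_at tendsto_at_iff_tendsto_nhds by (simp add: order_tendstoD)
  then have "\<forall>\<^sub>F x in nhds y. (dist_Delta (G x, H x))\<^sup>2 \<le> (max 0 (G x))\<^sup>2"
    by eventually_elim (auto simp: dist_Delta_eq intro!: power_mono)
  then show ?thesis
    using True GDERIV_pos_part_square[OF G]
    by (intro exI[of _ "\<lambda>x. (max 0 (G x))\<^sup>2"] exI[of _ "max 0 (G y)"] exI[of _ 0])
      (auto simp: dist_Delta_eq max_def min_def)
next
  case False
  \<comment> \<open>The point \<open>(a, 0)\<close> always lies in \<open>Delta\<close>, which makes
    this majorant global. The entry \<open>b\<close> is \<open>- H y\<close> because
    \<open>DH\<close> enters the gradient with a minus sign.\<close>
  have "(dist_Delta (G x, H x))\<^sup>2 \<le> (H x)\<^sup>2" for x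
    unfolding abs_le_square_iff[symmetric] by (auto simp: dist_Delta_eq)
  then show ?thesis
    using False GDERIV_square[OF H]
    by (intro exI[of _ "\<lambda>x. (H x)\<^sup>2"] exI[of _ 0] exI[of _ "- H y"])
      (auto simp: dist_Delta_eq max_def min_def mult_less_0_iff zero_less_mult_iff not_less neq_iff)
qed

section \<open>The Euclidean measure of infeasibility\<close>

definition mpvc_violation ::
  "nat \<Rightarrow> nat \<Rightarrow> nat \<Rightarrow>
   (nat \<Rightarrow> real ^ 'n \<Rightarrow> real) \<Rightarrow> (nat \<Rightarrow> real ^ 'n \<Rightarrow> real) \<Rightarrow>
   (nat \<Rightarrow> real ^ 'n \<Rightarrow> real) \<Rightarrow> (nat \<Rightarrow> real ^ 'n \<Rightarrow> real) \<Rightarrow> real ^ 'n \<Rightarrow> real" where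
  "mpvc_violation m p q g h G H x =
     sqrt ((\<Sum>i=1..m. (max 0 (g i x))\<^sup>2) + (\<Sum>i=1..p. (h i x)\<^sup>2)
           + (\<Sum>i=1..q. (dist_Delta (G i x, H i x))\<^sup>2))"

lemma mpvc_violation_nonneg: "0 \<le> mpvc_violation m p q g h G H x"
  unfolding mpvc_violation_def by (intro real_sqrt_ge_zero add_nonneg_nonneg sum_nonneg) auto

lemma mpvc_violation_eq_0_iff:
  "mpvc_violation m p q g h G H x = 0 \<longleftrightarrow> x \<in> mpvc_feasible m p q g h G H"
proof -
  have "mpvc_violation m p q g h G H x = 0 \<longleftrightarrow>
      (\<Sum>i=1..m. (max 0 (g i x))\<^sup>2) = 0 \<and> (\<Sum>i=1..p. (h i x)\<^sup>2) = 0 \<and>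
      (\<Sum>i=1..q. (dist_Delta (G i x, H i x))\<^sup>2) = 0"
    unfolding mpvc_violation_def real_sqrt_eq_0_iff
    by (simp add: add_nonneg_eq_0_iff sum_nonneg add_nonneg_nonneg)
  also have "\<dots> \<longleftrightarrow> x \<in> mpvc_feasible m p q g h G H"
    by (auto simp: sum_nonneg_eq_0_iff dist_Delta_eq_0_iff mpvc_feasible_def max_def
        split: if_splits)
  finally show ?thesis .
qed

text \<open>Subadditivity of the square root splits the three blocks; in each block the Euclidean
  norm is at most the sum of absolute values. An error bound in \<open>mpvc_violation\<close> thus
  carries over with the same constant.\<close>

lemma mpvc_violation_le:
  "mpvc_violation m p q g h G H x \<le>
    l1_norm p (\<lambda>i. h i x) + l1_norm m (\<lambda>i. max 0 (g i x)) + (\<Sum>i=1..q. dist_Delta (G i x, H i x))"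
proof -
  let ?g = "\<Sum>i=1..m. (max 0 (g i x))\<^sup>2" and ?h = "\<Sum>i=1..p. (h i x)\<^sup>2"
    and ?d = "\<Sum>i=1..q. (dist_Delta (G i x, H i x))\<^sup>2"
  have "mpvc_violation m p q g h G H x \<le> sqrt (?g + ?h) + sqrt ?d"
    unfolding mpvc_violation_def by (intro sqrt_add_le_add_sqrt add_nonneg_nonneg sum_nonneg) auto
  also have "sqrt (?g + ?h) \<le> sqrt ?g + sqrt ?h"
    by (intro sqrt_add_le_add_sqrt sum_nonneg) auto
  also have "sqrt ?g \<le> l1_norm m (\<lambda>i. max 0 (g i x))"
    unfolding l1_norm_def L2_set_def[symmetric] by (rule L2_set_le_sum_abs)
  also have "sqrt ?h \<le> l1_norm p (\<lambda>i. h i x)"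
    unfolding l1_norm_def L2_set_def[symmetric] by (rule L2_set_le_sum_abs)
  also have "sqrt ?d \<le> (\<Sum>i=1..q. dist_Delta (G i x, H i x))"
    unfolding L2_set_def[symmetric] by (rule L2_set_le_sum) (simp add: dist_Delta_eq)
  finally show ?thesis by simp
qed

lemma continuous_on_mpvc_violation:
  assumes "\<And>i. i \<in> {1..m} \<Longrightarrow> continuous_on S (g i)"
    and "\<And>i. i \<in> {1..p} \<Longrightarrow> continuous_on S (h i)"
    and "\<And>i. i \<in> {1..q} \<Longrightarrow> continuous_on S (G i)"
    and "\<And>i. i \<in> {1..q} \<Longrightarrow> continuous_on S (H i)"
  shows "continuous_on S (mpvc_violation m p q g h G H)"
  unfolding mpvc_violation_def[abs_def] dist_Delta_eq
  by (intro continuous_intros assms)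

section \<open>Approximate multipliers at infeasible points\<close>

text \<open>Unit length keeps limits of such multipliers nonzero. The comparisons of
  \<open>G i y\<close> with \<open>H i y\<close> record which branch of \<open>Delta\<close> was
  chosen at \<open>y\<close>; they decide which entries must vanish in the limit.\<close>

definition mpvc_approx_multipliers ::
  "nat \<Rightarrow> nat \<Rightarrow> nat \<Rightarrow>
   (nat \<Rightarrow> real ^ 'n \<Rightarrow> real) \<Rightarrow> (nat \<Rightarrow> real ^ 'n \<Rightarrow> real) \<Rightarrow>
   (nat \<Rightarrow> real ^ 'n \<Rightarrow> real) \<Rightarrow> (nat \<Rightarrow> real ^ 'n \<Rightarrow> real) \<Rightarrow> real \<Rightarrow> real ^ 'n \<Rightarrow>
   (nat \<Rightarrow> real) \<Rightarrow> (nat \<Rightarrow> real) \<Rightarrow> (nat \<Rightarrow> real) \<Rightarrow> (nat \<Rightarrow> real) \<Rightarrow> bool" where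
  "mpvc_approx_multipliers m p q g h G H \<epsilon> y lam mu etaG etaH \<longleftrightarrow>
     (\<Sum>i=1..m. (lam i)\<^sup>2) + (\<Sum>i=1..p. (mu i)\<^sup>2) + (\<Sum>i=1..q. (etaG i)\<^sup>2)
       + (\<Sum>i=1..q. (etaH i)\<^sup>2) = 1 \<and>
     norm ((\<Sum>i=1..m. lam i *\<^sub>R gradient (g i) y) + (\<Sum>i=1..p. mu i *\<^sub>R gradient (h i) y)
         + (\<Sum>i=1..q. etaG i *\<^sub>R gradient (G i) y)
         - (\<Sum>i=1..q. etaH i *\<^sub>R gradient (H i) y)) \<le> \<epsilon> \<and>
     (\<forall>i\<in>{1..m}. 0 \<le> lam i \<and> (lam i \<noteq> 0 \<longrightarrow> 0 < g i y)) \<and>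
     (\<forall>i\<in>{1..p}. mu i \<noteq> 0 \<longrightarrow> 0 < mu i * h i y) \<and>
     (\<forall>i\<in>{1..q}. 0 \<le> etaG i \<and> etaG i * etaH i = 0 \<and>
        (etaG i \<noteq> 0 \<longrightarrow> 0 < G i y \<and> G i y \<le> H i y) \<and>
        (etaH i \<noteq> 0 \<longrightarrow> etaH i * H i y < 0 \<and> (H i y < 0 \<or> H i y < G i y)))"

text \<open>Replacing each squared distance by a smooth majorant that touches it at \<open>y\<close>
  preserves the local minimality in \<open>calm\<close>. The resulting function is differentiable at
  \<open>y\<close> because \<open>\<psi> y\<close> is positive, and its gradient has norm at most
  \<open>\<epsilon>\<close>.\<close>

lemma mpvc_approx_multipliers_exist:
  fixes g h G H :: "nat \<Rightarrow> real ^ 'n \<Rightarrow> real" and y :: "real ^ 'n" and m p q :: nat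
  defines "\<psi> \<equiv> mpvc_violation m p q g h G H"
  assumes dg: "\<And>i. i \<in> {1..m} \<Longrightarrow> GDERIV (g i) y :> gradient (g i) y"
    and dh: "\<And>i. i \<in> {1..p} \<Longrightarrow> GDERIV (h i) y :> gradient (h i) y"
    and dG: "\<And>i. i \<in> {1..q} \<Longrightarrow> GDERIV (G i) y :> gradient (G i) y"
    and dH: "\<And>i. i \<in> {1..q} \<Longrightarrow> GDERIV (H i) y :> gradient (H i) y"
    and pos: "0 < \<psi> y" and \<epsilon>: "0 \<le> \<epsilon>"
    and calm: "\<forall>\<^sub>F x in nhds y. \<psi> y \<le> \<psi> x + \<epsilon> * dist x y"
  shows "\<exists>lam mu etaG etaH. mpvc_approx_multipliers m p q g h G H \<epsilon> y lam mu etaG etaH"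
proof -
  \<comment> \<open>\<open>P\<close> packages the conclusion of
    \<open>dist_Delta_square_model\<close>, so that one choice yields the majorant and both entries
    for every index.\<close>
  define P where "P i \<phi> a b \<longleftrightarrow>
    GDERIV \<phi> y :> 2 *\<^sub>R (a *\<^sub>R gradient (G i) y - b *\<^sub>R gradient (H i) y) \<and>
    \<phi> y = a\<^sup>2 + b\<^sup>2 \<and> a\<^sup>2 + b\<^sup>2 = (dist_Delta (G i y, H i y))\<^sup>2 \<and>
    (\<forall>\<^sub>F x in nhds y. (dist_Delta (G i x, H i x))\<^sup>2 \<le> \<phi> x) \<and>
    0 \<le> a \<and> a * b = 0 \<and> (a \<noteq> 0 \<longrightarrow> 0 < G i y \<and> G i y \<le> H i y) \<and>
    (b \<noteq> 0 \<longrightarrow> b * H i y < 0 \<and> (H i y < 0 \<or> H i y < G i y))" for i \<phi> a b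
  have "\<exists>\<phi> a b. P i \<phi> a b" if "i \<in> {1..q}" for i
    unfolding P_def by (intro dist_Delta_square_model dG dH that)
  then obtain \<phi> a b where P: "\<And>i. i \<in> {1..q} \<Longrightarrow> P i (\<phi> i) (a i) (b i)"
    by metis
  then have
    \<phi>: "\<And>i. i \<in> {1..q} \<Longrightarrow>
      GDERIV (\<phi> i) y :> 2 *\<^sub>R (a i *\<^sub>R gradient (G i) y - b i *\<^sub>R gradient (H i) y)"
    and \<phi>y: "\<And>i. i \<in> {1..q} \<Longrightarrow> \<phi> i y = (a i)\<^sup>2 + (b i)\<^sup>2"
    and ab: "\<And>i. i \<in> {1..q} \<Longrightarrow> (a i)\<^sup>2 + (b i)\<^sup>2 = (dist_Delta (G i y, H i y))\<^sup>2"
    and \<phi>_ge: "\<And>i. i \<in> {1..q} \<Longrightarrow>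
      \<forall>\<^sub>F x in nhds y. (dist_Delta (G i x, H i x))\<^sup>2 \<le> \<phi> i x"
    and signs: "\<And>i. i \<in> {1..q} \<Longrightarrow>
      0 \<le> a i \<and> a i * b i = 0 \<and> (a i \<noteq> 0 \<longrightarrow> 0 < G i y \<and> G i y \<le> H i y) \<and>
      (b i \<noteq> 0 \<longrightarrow> b i * H i y < 0 \<and> (H i y < 0 \<or> H i y < G i y))"
    unfolding P_def by blast+
  define r where "r = \<psi> y"
  have "r > 0" using pos by (simp add: r_def)
  define N where
    "N x = (\<Sum>i=1..m. (max 0 (g i x))\<^sup>2) + (\<Sum>i=1..p. (h i x)\<^sup>2) + (\<Sum>i=1..q. \<phi> i x)" for x
  define v where
    "v = (\<Sum>i=1..m. max 0 (g i y) *\<^sub>R gradient (g i) y) + (\<Sum>i=1..p. h i y *\<^sub>R gradient (h i) y)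
       + (\<Sum>i=1..q. a i *\<^sub>R gradient (G i) y - b i *\<^sub>R gradient (H i) y)"
  have Ny: "sqrt (N y) = r"
    by (simp add: N_def r_def \<psi>_def mpvc_violation_def \<phi>y ab)
  with \<open>r > 0\<close> have "N y > 0" by (metis real_sqrt_gt_0_iff)
  have "GDERIV N y :> 2 *\<^sub>R v"
    unfolding N_def v_def scaleR_add_right scaleR_sum_right
    by (intro GDERIV_add GDERIV_sum GDERIV_square GDERIV_pos_part_square \<phi> dg dh)
  \<comment> \<open>The 2 from the squares cancels against the derivative of the square root,
    leaving the residuals divided by \<open>r\<close>.\<close>
  from GDERIV_DERIV_compose[OF this DERIV_real_sqrt[OF \<open>N y > 0\<close>]]
  have "GDERIV (\<lambda>x. sqrt (N x)) y :> inverse r *\<^sub>R v"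
    by (simp add: Ny)
  moreover
  have "\<forall>\<^sub>F x in nhds y. \<forall>i\<in>{1..q}. (dist_Delta (G i x, H i x))\<^sup>2 \<le> \<phi> i x"
    using \<phi>_ge by (simp add: eventually_ball_finite)
  then have "\<forall>\<^sub>F x in nhds y. sqrt (N y) \<le> sqrt (N x) + \<epsilon> * dist x y"
    using calm
  proof eventually_elim
    case (elim x)
    then have "\<psi> x \<le> sqrt (N x)"
      unfolding \<psi>_def mpvc_violation_def N_def
      by (intro real_sqrt_le_mono add_left_mono sum_mono) auto
    then show ?case using elim Ny by (simp add: r_def)
  qed
  ultimately have "norm (inverse r *\<^sub>R v) \<le> \<epsilon>"
    using GDERIV_norm_le_if_calm \<epsilon> by blast
  also have "inverse r *\<^sub>R v =
      (\<Sum>i=1..m. (max 0 (g i y) / r) *\<^sub>R gradient (g i) y)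
      + (\<Sum>i=1..p. (h i y / r) *\<^sub>R gradient (h i) y)
      + (\<Sum>i=1..q. (a i / r) *\<^sub>R gradient (G i) y) - (\<Sum>i=1..q. (b i / r) *\<^sub>R gradient (H i) y)"
    unfolding v_def
    by (simp add: scaleR_add_right scaleR_sum_right scaleR_diff_right sum_subtractf
        divide_inverse mult.commute)
  finally have stat: "norm \<dots> \<le> \<epsilon>" .
  \<comment> \<open>The squared residuals sum to \<open>r\<^sup>2\<close>, so division by
    \<open>r\<close> gives a unit vector.\<close>
  have "(\<Sum>i=1..m. (max 0 (g i y))\<^sup>2) + (\<Sum>i=1..p. (h i y)\<^sup>2) + (\<Sum>i=1..q. (a i)\<^sup>2 + (b i)\<^sup>2) = r\<^sup>2"
    using Ny \<open>N y > 0\<close> by (simp add: N_def \<phi>y flip: Ny)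
  then have norm1: "(\<Sum>i=1..m. (max 0 (g i y) / r)\<^sup>2) + (\<Sum>i=1..p. (h i y / r)\<^sup>2)
      + (\<Sum>i=1..q. (a i / r)\<^sup>2) + (\<Sum>i=1..q. (b i / r)\<^sup>2) = 1"
    using \<open>r > 0\<close>
    by (simp add: power_divide sum.distrib flip: sum_divide_distrib add_divide_distrib add.assoc)
  show ?thesis
    unfolding mpvc_approx_multipliers_def
  proof (intro exI conjI)
    show "\<forall>i\<in>{1..m}. 0 \<le> max 0 (g i y) / r \<and> (max 0 (g i y) / r \<noteq> 0 \<longrightarrow> 0 < g i y)"
      using \<open>r > 0\<close> by (auto simp: max_def)
    show "\<forall>i\<in>{1..p}. h i y / r \<noteq> 0 \<longrightarrow> 0 < h i y / r * h i y"
      using \<open>r > 0\<close> by (auto simp: zero_less_mult_iff neq_iff)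
    show "\<forall>i\<in>{1..q}. 0 \<le> a i / r \<and> a i / r * (b i / r) = 0 \<and>
        (a i / r \<noteq> 0 \<longrightarrow> 0 < G i y \<and> G i y \<le> H i y) \<and>
        (b i / r \<noteq> 0 \<longrightarrow> b i / r * H i y < 0 \<and> (H i y < 0 \<or> H i y < G i y))"
      using signs \<open>r > 0\<close> by (auto simp: divide_less_0_iff)
  qed (fact norm1 stat)+
qed


section \<open>Limits of approximate multipliers\<close>

text \<open>A cluster point of the unit multipliers is the forbidden multiplier: continuity of the
  gradients gives stationarity, and the points \<open>Y k\<close> themselves, after passing to a
  tail of a subsequence, form the sequence required in the definition.\<close>

lemma not_quasinormal_if_approx_multipliers:
  fixes g h G H :: "nat \<Rightarrow> real ^ 'n \<Rightarrow> real" and xs :: "real ^ 'n"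
  assumes cg: "\<And>i. i \<in> {1..m} \<Longrightarrow> continuously_differentiable (g i)"
    and ch: "\<And>i. i \<in> {1..p} \<Longrightarrow> continuously_differentiable (h i)"
    and cG: "\<And>i. i \<in> {1..q} \<Longrightarrow> continuously_differentiable (G i)"
    and cH: "\<And>i. i \<in> {1..q} \<Longrightarrow> continuously_differentiable (H i)"
    and feas: "xs \<in> mpvc_feasible m p q g h G H"
    and \<epsilon>: "\<epsilon> \<longlonglongrightarrow> 0" and Y: "Y \<longlonglongrightarrow> xs"
    and approx: "\<And>k. mpvc_approx_multipliers m p q g h G H (\<epsilon> k) (Y k) (la k) (mu k) (eG k) (eH k)"
  shows "\<not> mpvc_generalized_quasinormal m p q g h G H xs"
proof -
  note approx' = approx[unfolded mpvc_approx_multipliers_def]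
  have norm1: "(\<Sum>i=1..m. (la k i)\<^sup>2) + (\<Sum>i=1..p. (mu k i)\<^sup>2) + (\<Sum>i=1..q. (eG k i)\<^sup>2)
       + (\<Sum>i=1..q. (eH k i)\<^sup>2) = 1" for k
    using approx' by blast
  have stat: "norm ((\<Sum>i=1..m. la k i *\<^sub>R gradient (g i) (Y k))
       + (\<Sum>i=1..p. mu k i *\<^sub>R gradient (h i) (Y k))
       + (\<Sum>i=1..q. eG k i *\<^sub>R gradient (G i) (Y k))
       - (\<Sum>i=1..q. eH k i *\<^sub>R gradient (H i) (Y k))) \<le> \<epsilon> k" for k
    using approx' by blast
  have la: "0 \<le> la k i" "la k i \<noteq> 0 \<Longrightarrow> 0 < g i (Y k)" if "i \<in> {1..m}" for k i
    using approx' that by blast+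
  have mu: "mu k i \<noteq> 0 \<Longrightarrow> 0 < mu k i * h i (Y k)" if "i \<in> {1..p}" for k i
    using approx' that by blast
  have eG: "0 \<le> eG k i" "eG k i * eH k i = 0"
    "eG k i \<noteq> 0 \<Longrightarrow> 0 < G i (Y k)" "eG k i \<noteq> 0 \<Longrightarrow> G i (Y k) \<le> H i (Y k)"
    and eH: "eH k i \<noteq> 0 \<Longrightarrow> eH k i * H i (Y k) < 0"
    "eH k i \<noteq> 0 \<Longrightarrow> H i (Y k) < 0 \<or> H i (Y k) < G i (Y k)" if "i \<in> {1..q}" for k i
    using approx' that by blast+

  have member_le_1: "\<bar>c i\<bar> \<le> 1" if "i \<in> {1..n}" "(\<Sum>i=1..n. (c i)\<^sup>2) \<le> 1"
    for c :: "nat \<Rightarrow> real" and i n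
  proof -
    have "(c i)\<^sup>2 \<le> (\<Sum>i=1..n. (c i)\<^sup>2)"
      using that by (intro member_le_sum) auto
    then have "(c i)\<^sup>2 \<le> 1" using that(2) by linarith
    then show ?thesis by (simp add: abs_square_le_1)
  qed
  have sq_le: "(\<Sum>i=1..m. (la k i)\<^sup>2) \<le> 1" "(\<Sum>i=1..p. (mu k i)\<^sup>2) \<le> 1"
    "(\<Sum>i=1..q. (eG k i)\<^sup>2) \<le> 1" "(\<Sum>i=1..q. (eH k i)\<^sup>2) \<le> 1" for k
  proof -
    have "0 \<le> (\<Sum>i=1..m. (la k i)\<^sup>2)" "0 \<le> (\<Sum>i=1..p. (mu k i)\<^sup>2)"
      "0 \<le> (\<Sum>i=1..q. (eG k i)\<^sup>2)" "0 \<le> (\<Sum>i=1..q. (eH k i)\<^sup>2)"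
      by (auto intro: sum_nonneg)
    with norm1[of k] show "(\<Sum>i=1..m. (la k i)\<^sup>2) \<le> 1" "(\<Sum>i=1..p. (mu k i)\<^sup>2) \<le> 1"
      "(\<Sum>i=1..q. (eG k i)\<^sup>2) \<le> 1" "(\<Sum>i=1..q. (eH k i)\<^sup>2) \<le> 1"
      by linarith+
  qed
  \<comment> \<open>The disjoint union stacks the four families, so that a single subsequence makes
    all of them converge.\<close>
  define J where "J = {1..m} <+> {1..p} <+> {1..q} <+> {1..q}"
  define u where "u k = case_sum (la k) (case_sum (mu k) (case_sum (eG k) (eH k)))" for k
  have "\<bar>u k j\<bar> \<le> 1" if "j \<in> J" for j k
    using that member_le_1[OF _ sq_le(1)] member_le_1[OF _ sq_le(2)]
      member_le_1[OF _ sq_le(3)] member_le_1[OF _ sq_le(4)]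
    by (auto simp: J_def u_def)
  moreover have "finite J" by (simp add: J_def)
  ultimately obtain l r where r: "strict_mono (r :: nat \<Rightarrow> nat)"
    and l: "\<And>j. j \<in> J \<Longrightarrow> (\<lambda>k. u (r k) j) \<longlonglongrightarrow> l j"
    using finite_family_convergent_subseq[of J u 1] by blast
  define lam mus etaG etaH where
    "lam i = l (Inl i)" and "mus i = l (Inr (Inl i))" and
    "etaG i = l (Inr (Inr (Inl i)))" and "etaH i = l (Inr (Inr (Inr i)))" for i
  have llam: "(\<lambda>k. la (r k) i) \<longlonglongrightarrow> lam i" if "i \<in> {1..m}" for i
    using l[unfolded J_def, OF InlI[OF that]] by (simp add: u_def lam_def)
  have lmu: "(\<lambda>k. mu (r k) i) \<longlonglongrightarrow> mus i" if "i \<in> {1..p}" for i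
    using l[unfolded J_def, OF InrI[OF InlI[OF that]]] by (simp add: u_def mus_def)
  have leG: "(\<lambda>k. eG (r k) i) \<longlonglongrightarrow> etaG i" if "i \<in> {1..q}" for i
    using l[unfolded J_def, OF InrI[OF InrI[OF InlI[OF that]]]] by (simp add: u_def etaG_def)
  have leH: "(\<lambda>k. eH (r k) i) \<longlonglongrightarrow> etaH i" if "i \<in> {1..q}" for i
    using l[unfolded J_def, OF InrI[OF InrI[OF InrI[OF that]]]] by (simp add: u_def etaH_def)
  have Yr: "(\<lambda>k. Y (r k)) \<longlonglongrightarrow> xs"
    using LIMSEQ_subseq_LIMSEQ[OF Y r] by (simp add: o_def)
  have \<epsilon>r: "(\<lambda>k. \<epsilon> (r k)) \<longlonglongrightarrow> 0"
    using LIMSEQ_subseq_LIMSEQ[OF \<epsilon> r] by (simp add: o_def)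
  have grad: "(\<lambda>k. gradient F (Y (r k))) \<longlonglongrightarrow> gradient F xs"
    and val: "(\<lambda>k. F (Y (r k))) \<longlonglongrightarrow> F xs"
    if "continuously_differentiable F" for F :: "real ^ 'n \<Rightarrow> real"
  proof -
    show "(\<lambda>k. gradient F (Y (r k))) \<longlonglongrightarrow> gradient F xs"
      using that Yr unfolding continuously_differentiable_def
      by (auto intro: continuous_on_tendsto_compose[of UNIV])
    have "isCont F xs"
      using that unfolding continuously_differentiable_def
      by (blast intro: differentiable_imp_continuous_within)
    then show "(\<lambda>k. F (Y (r k))) \<longlonglongrightarrow> F xs"
      using Yr by (rule isCont_tendsto_compose)
  qed

  \<comment> \<open>Stationarity and nontriviality of the limit\<close>
  have "(\<lambda>k. (\<Sum>i=1..m. la (r k) i *\<^sub>R gradient (g i) (Y (r k)))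
       + (\<Sum>i=1..p. mu (r k) i *\<^sub>R gradient (h i) (Y (r k)))
       + (\<Sum>i=1..q. eG (r k) i *\<^sub>R gradient (G i) (Y (r k)))
       - (\<Sum>i=1..q. eH (r k) i *\<^sub>R gradient (H i) (Y (r k))))
     \<longlonglongrightarrow> (\<Sum>i=1..m. lam i *\<^sub>R gradient (g i) xs) + (\<Sum>i=1..p. mus i *\<^sub>R gradient (h i) xs)
       + (\<Sum>i=1..q. etaG i *\<^sub>R gradient (G i) xs) - (\<Sum>i=1..q. etaH i *\<^sub>R gradient (H i) xs)"
    by (intro tendsto_intros llam lmu leG leH grad cg ch cG cH)
  moreover have "(\<lambda>k. (\<Sum>i=1..m. la (r k) i *\<^sub>R gradient (g i) (Y (r k)))
       + (\<Sum>i=1..p. mu (r k) i *\<^sub>R gradient (h i) (Y (r k)))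
       + (\<Sum>i=1..q. eG (r k) i *\<^sub>R gradient (G i) (Y (r k)))
       - (\<Sum>i=1..q. eH (r k) i *\<^sub>R gradient (H i) (Y (r k)))) \<longlonglongrightarrow> 0"
    using \<epsilon>r by (rule Lim_null_comparison[rotated]) (intro always_eventually allI stat)
  ultimately have stationary:
    "(\<Sum>i=1..m. lam i *\<^sub>R gradient (g i) xs) + (\<Sum>i=1..p. mus i *\<^sub>R gradient (h i) xs)
       + (\<Sum>i=1..q. etaG i *\<^sub>R gradient (G i) xs)
       - (\<Sum>i=1..q. etaH i *\<^sub>R gradient (H i) xs) = 0"
    by (rule LIMSEQ_unique)

  have "(\<lambda>k. (\<Sum>i=1..m. (la (r k) i)\<^sup>2) + (\<Sum>i=1..p. (mu (r k) i)\<^sup>2)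
       + (\<Sum>i=1..q. (eG (r k) i)\<^sup>2) + (\<Sum>i=1..q. (eH (r k) i)\<^sup>2))
     \<longlonglongrightarrow> (\<Sum>i=1..m. (lam i)\<^sup>2) + (\<Sum>i=1..p. (mus i)\<^sup>2) + (\<Sum>i=1..q. (etaG i)\<^sup>2)
       + (\<Sum>i=1..q. (etaH i)\<^sup>2)"
    by (intro tendsto_intros llam lmu leG leH)
  then have norm1_lim: "(\<Sum>i=1..m. (lam i)\<^sup>2) + (\<Sum>i=1..p. (mus i)\<^sup>2) + (\<Sum>i=1..q. (etaG i)\<^sup>2)
       + (\<Sum>i=1..q. (etaH i)\<^sup>2) = 1"
    unfolding norm1 by (simp add: LIMSEQ_const_iff)
  have nonzero: "(\<exists>i\<in>{1..m}. lam i \<noteq> 0) \<or> (\<exists>i\<in>{1..p}. mus i \<noteq> 0) \<or>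
      (\<exists>i\<in>{1..q}. etaG i \<noteq> 0) \<or> (\<exists>i\<in>{1..q}. etaH i \<noteq> 0)"
  proof (rule ccontr)
    assume "\<not> ?thesis"
    then have "(\<Sum>i=1..m. (lam i)\<^sup>2) = 0" "(\<Sum>i=1..p. (mus i)\<^sup>2) = 0"
      "(\<Sum>i=1..q. (etaG i)\<^sup>2) = 0" "(\<Sum>i=1..q. (etaH i)\<^sup>2) = 0"
      by (auto intro!: sum.neutral)
    with norm1_lim show False by simp
  qed

  \<comment> \<open>Signs and complementarity of the limit\<close>
  have lim_eq_0: "c = 0" if "a \<longlonglongrightarrow> c" "\<forall>\<^sub>F k in sequentially. a k = 0"
    for a :: "nat \<Rightarrow> real" and c
    using that by (metis LIMSEQ_unique tendsto_eventually)
  have lam_nonneg: "0 \<le> lam i" if "i \<in> {1..m}" for i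
    using llam[OF that] la(1)[OF that] by (intro LIMSEQ_le_const) auto
  have etaG_nonneg: "0 \<le> etaG i" if "i \<in> {1..q}" for i
    using leG[OF that] eG(1)[OF that] by (intro LIMSEQ_le_const) auto
  have lam_inactive: "lam i = 0" if "i \<in> {1..m} - I_active m g xs" for i
  proof (rule lim_eq_0)
    have i: "i \<in> {1..m}" and "g i xs < 0"
      using that feas by (auto simp: I_active_def mpvc_feasible_def less_le)
    show "(\<lambda>k. la (r k) i) \<longlonglongrightarrow> lam i" using i by (rule llam)
    show "\<forall>\<^sub>F k in sequentially. la (r k) i = 0"
      using order_tendstoD(2)[OF val[OF cg[OF i]] \<open>g i xs < 0\<close>]
      by eventually_elim (use la(2)[OF i] in force)
  qed
  \<comment> \<open>With no condition on \<open>H i xs\<close>, this serves both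
    \<open>I_pos_neg\<close> and \<open>I_zero_neg\<close>.\<close>
  have etaG_zero_neg: "etaG i = 0" if i: "i \<in> {1..q}" and "G i xs < 0" for i
  proof (rule lim_eq_0[OF leG[OF i]])
    show "\<forall>\<^sub>F k in sequentially. eG (r k) i = 0"
      using order_tendstoD(2)[OF val[OF cG[OF i]] \<open>G i xs < 0\<close>]
      by eventually_elim (use eG(3)[OF i] in force)
  qed
  have ev_less: "\<forall>\<^sub>F k in sequentially. F (Y (r k)) < F' (Y (r k))"
    if "continuously_differentiable F" "continuously_differentiable F'" "F xs < F' xs"
    for F F' :: "real ^ 'n \<Rightarrow> real"
  proof -
    have "(\<lambda>k. F' (Y (r k)) - F (Y (r k))) \<longlonglongrightarrow> F' xs - F xs"
      by (intro tendsto_intros val that)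
    from order_tendstoD(1)[OF this, of 0] that(3) show ?thesis by simp
  qed
  \<comment> \<open>Near \<open>xs\<close> the value of \<open>G i\<close> exceeds that of
    \<open>H i\<close>, whereas a nonzero \<open>eG\<close> requires the opposite order.\<close>
  have etaG_zero_pos: "etaG i = 0" if i: "i \<in> {1..q}" and "H i xs = 0" "0 < G i xs" for i
  proof (rule lim_eq_0[OF leG[OF i]])
    have "\<forall>\<^sub>F k in sequentially. H i (Y (r k)) < G i (Y (r k))"
      using that(2,3) by (intro ev_less cG cH i) simp
    then show "\<forall>\<^sub>F k in sequentially. eG (r k) i = 0"
      by eventually_elim (use eG(4)[OF i] in force)
  qed
  \<comment> \<open>Feasibility forces \<open>G i xs \<le> 0 < H i xs\<close>; near
    \<open>xs\<close> both alternatives for a nonzero \<open>eH\<close> therefore fail.\<close>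
  have etaH_pos: "etaH i = 0" if i: "i \<in> {1..q}" and "0 < H i xs" for i
  proof (rule lim_eq_0[OF leH[OF i]])
    have "G i xs * H i xs \<le> 0"
      using feas i by (simp add: mpvc_feasible_def)
    then have "G i xs \<le> 0"
      using \<open>0 < H i xs\<close> by (simp add: mult_le_0_iff)
    then have "\<forall>\<^sub>F k in sequentially. G i (Y (r k)) < H i (Y (r k))"
      using \<open>0 < H i xs\<close> by (intro ev_less cG cH i) auto
    with order_tendstoD(1)[OF val[OF cH[OF i]] \<open>0 < H i xs\<close>]
    show "\<forall>\<^sub>F k in sequentially. eH (r k) i = 0"
      by eventually_elim (use eH(2)[OF i] in force)
  qed
  \<comment> \<open>A negative \<open>eH\<close> would need \<open>0 < H i\<close> and hence
    \<open>H i < G i\<close> at \<open>Y (r k)\<close>, but \<open>G i\<close> is eventually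
    negative there.\<close>
  have etaH_nonneg: "0 \<le> etaH i" if i: "i \<in> {1..q}" and "H i xs = 0" "G i xs < 0" for i
  proof (rule tendsto_lowerbound[OF leH[OF i]])
    show "\<forall>\<^sub>F k in sequentially. 0 \<le> eH (r k) i"
      using order_tendstoD(2)[OF val[OF cG[OF i]] \<open>G i xs < 0\<close>]
    proof eventually_elim
      case (elim k)
      show ?case
      proof (rule ccontr)
        assume "\<not> 0 \<le> eH (r k) i"
        then have "0 < H i (Y (r k))"
          using eH(1)[OF i, of "r k"] by (simp add: mult_less_0_iff)
        then show False
          using eH(2)[OF i, of "r k"] elim \<open>\<not> 0 \<le> eH (r k) i\<close> by simp
      qed
    qed
  qed simp
  have compl: "etaH i * etaG i = 0" if i: "i \<in> {1..q}" for i
  proof (rule lim_eq_0)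
    show "(\<lambda>k. eH (r k) i * eG (r k) i) \<longlonglongrightarrow> etaH i * etaG i"
      by (intro tendsto_intros leH leG i)
    show "\<forall>\<^sub>F k in sequentially. eH (r k) i * eG (r k) i = 0"
      using eG(2)[OF i] by (simp add: mult.commute)
  qed

  \<comment> \<open>The sequence of points with violated constraints\<close>
  have ev_sign: "\<forall>\<^sub>F k in sequentially. 0 < c * a k" if "a \<longlonglongrightarrow> c" "c \<noteq> 0"
    for a :: "nat \<Rightarrow> real" and c
  proof -
    have "(\<lambda>k. c * a k) \<longlonglongrightarrow> c * c"
      by (intro tendsto_intros that)
    moreover have "0 < c * c" using that(2) by (auto simp: zero_less_mult_iff neq_iff)
    ultimately show ?thesis by (rule order_tendstoD)
  qed
  \<comment> \<open>By \<open>ev_sign\<close>, entries with a nonzero limit eventually share its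
    sign; the sign relations between entries and constraint values at \<open>Y (r k)\<close> then
    pass to the limit multipliers.\<close>
  have "\<forall>\<^sub>F k in sequentially.
      (\<forall>i\<in>{1..m}. lam i > 0 \<longrightarrow> lam i * g i (Y (r k)) > 0) \<and>
      (\<forall>i\<in>{1..p}. mus i \<noteq> 0 \<longrightarrow> mus i * h i (Y (r k)) > 0) \<and>
      (\<forall>i\<in>{1..q}. etaH i \<noteq> 0 \<longrightarrow> etaH i * H i (Y (r k)) < 0) \<and>
      (\<forall>i\<in>{1..q}. etaG i > 0 \<longrightarrow> etaG i * G i (Y (r k)) > 0)"
  proof (intro eventually_conj eventually_ball_finite ballI finite_atLeastAtMost)
    fix i assume i: "i \<in> {1..m}"
    show "\<forall>\<^sub>F k in sequentially. lam i > 0 \<longrightarrow> lam i * g i (Y (r k)) > 0"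
      using ev_sign[OF llam[OF i]] la(2)[OF i]
      by (cases "lam i = 0") (auto elim!: eventually_mono simp: zero_less_mult_iff)
  next
    fix i assume i: "i \<in> {1..p}"
    show "\<forall>\<^sub>F k in sequentially. mus i \<noteq> 0 \<longrightarrow> mus i * h i (Y (r k)) > 0"
    proof (cases "mus i = 0")
      case False
      show ?thesis using ev_sign[OF lmu[OF i] False]
      proof eventually_elim
        case (elim k)
        then show ?case using mu[OF i, of "r k"] by (auto simp: zero_less_mult_iff)
      qed
    qed simp
  next
    fix i assume i: "i \<in> {1..q}"
    show "\<forall>\<^sub>F k in sequentially. etaH i \<noteq> 0 \<longrightarrow> etaH i * H i (Y (r k)) < 0"
    proof (cases "etaH i = 0")
      case False
      show ?thesis using ev_sign[OF leH[OF i] False]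
      proof eventually_elim
        case (elim k)
        then show ?case using eH(1)[OF i, of "r k"] by (auto simp: zero_less_mult_iff mult_less_0_iff)
      qed
    qed simp
  next
    fix i assume i: "i \<in> {1..q}"
    show "\<forall>\<^sub>F k in sequentially. etaG i > 0 \<longrightarrow> etaG i * G i (Y (r k)) > 0"
      using ev_sign[OF leG[OF i]] eG(3)[OF i]
      by (cases "etaG i = 0") (auto elim!: eventually_mono simp: zero_less_mult_iff)
  qed
  then obtain K where K: "\<And>k. K \<le> k \<Longrightarrow>
      (\<forall>i\<in>{1..m}. lam i > 0 \<longrightarrow> lam i * g i (Y (r k)) > 0) \<and>
      (\<forall>i\<in>{1..p}. mus i \<noteq> 0 \<longrightarrow> mus i * h i (Y (r k)) > 0) \<and>
      (\<forall>i\<in>{1..q}. etaH i \<noteq> 0 \<longrightarrow> etaH i * H i (Y (r k)) < 0) \<and>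
      (\<forall>i\<in>{1..q}. etaG i > 0 \<longrightarrow> etaG i * G i (Y (r k)) > 0)"
    unfolding eventually_sequentially by blast
  \<comment> \<open>The definition demands the strict inequalities for every index, so an initial
    segment is dropped.\<close>
  define X where "X k = Y (r (k + K))" for k
  have "X \<longlonglongrightarrow> xs"
    unfolding X_def using Yr by (rule LIMSEQ_ignore_initial_segment)
  moreover have "\<forall>k. (\<forall>i\<in>{1..m}. lam i > 0 \<longrightarrow> lam i * g i (X k) > 0) \<and>
      (\<forall>i\<in>{1..p}. mus i \<noteq> 0 \<longrightarrow> mus i * h i (X k) > 0) \<and>
      (\<forall>i\<in>{1..q}. etaH i \<noteq> 0 \<longrightarrow> etaH i * H i (X k) < 0) \<and>
      (\<forall>i\<in>{1..q}. etaG i > 0 \<longrightarrow> etaG i * G i (X k) > 0)"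
    unfolding X_def by (intro allI K) simp
  ultimately have seq: "\<exists>X. X \<longlonglongrightarrow> xs \<and>
      (\<forall>k. (\<forall>i\<in>{1..m}. lam i > 0 \<longrightarrow> lam i * g i (X k) > 0) \<and>
      (\<forall>i\<in>{1..p}. mus i \<noteq> 0 \<longrightarrow> mus i * h i (X k) > 0) \<and>
      (\<forall>i\<in>{1..q}. etaH i \<noteq> 0 \<longrightarrow> etaH i * H i (X k) < 0) \<and>
      (\<forall>i\<in>{1..q}. etaG i > 0 \<longrightarrow> etaG i * G i (X k) > 0))"
    by blast
  show ?thesis
    unfolding mpvc_generalized_quasinormal_def not_not
  proof (rule exI[of _ lam], rule exI[of _ mus], rule exI[of _ etaG], rule exI[of _ etaH],
      intro conjI ballI)
    show "lam i \<ge> 0" if "i \<in> I_active m g xs" for i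
      using lam_nonneg that by (simp add: I_active_def)
    show "lam i = 0" if "i \<in> {1..m} - I_active m g xs" for i
      using that by (rule lam_inactive)
    show "etaG i = 0" if "i \<in> I_pos_neg q G H xs \<union> I_zero_neg q G H xs \<union> I_zero_pos q G H xs" for i
      using that etaG_zero_neg[of i] etaG_zero_pos[of i]
      by (auto simp: I_pos_neg_def I_zero_neg_def I_zero_pos_def)
    show "etaG i \<ge> 0" if "i \<in> I_pos_zero q G H xs \<union> I_zero_zero q G H xs" for i
      using that etaG_nonneg[of i] by (auto simp: I_pos_zero_def I_zero_zero_def)
    show "etaH i = 0" if "i \<in> I_pos q H xs" for i
      using that etaH_pos[of i] by (simp add: I_pos_def)
    show "etaH i \<ge> 0" if "i \<in> I_zero_neg q G H xs" for i
      using that etaH_nonneg[of i] by (simp add: I_zero_neg_def)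
    show "etaH i * etaG i = 0" if "i \<in> I_zero_zero q G H xs" for i
      using that compl[of i] by (simp add: I_zero_zero_def)
  qed (fact nonzero stationary seq)+
qed

section \<open>The error bound near a generalized quasinormal point\<close>

theorem theorem5p2:
  fixes m p q :: nat
    and f :: "real ^ 'n \<Rightarrow> real"
    and g h G H :: "nat \<Rightarrow> real ^ 'n \<Rightarrow> real"
    and xstar :: "real ^ 'n"
  assumes "continuously_differentiable f"
    and "\<And>i. i \<in> {1..m} \<Longrightarrow> continuously_differentiable (g i)"
    and "\<And>i. i \<in> {1..p} \<Longrightarrow> continuously_differentiable (h i)"
    and "\<And>i. i \<in> {1..q} \<Longrightarrow> continuously_differentiable (G i)"
    and "\<And>i. i \<in> {1..q} \<Longrightarrow> continuously_differentiable (H i)"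
    and "xstar \<in> mpvc_feasible m p q g h G H"
    and "mpvc_generalized_quasinormal m p q g h G H xstar"
  shows "\<exists>\<delta>>0. \<exists>c>0. \<forall>x\<in>cball xstar (\<delta> / 2).
    infdist x (mpvc_feasible m p q g h G H) \<le>
      c * (l1_norm p (\<lambda>i. h i x) + l1_norm m (\<lambda>i. max 0 (g i x))
           + (\<Sum>i=1..q. dist_Delta (G i x, H i x)))"
proof -
  define \<psi> where "\<psi> = mpvc_violation m p q g h G H"
  have zeros: "{x. \<psi> x = 0} = mpvc_feasible m p q g h G H"
    by (simp add: \<psi>_def mpvc_violation_eq_0_iff)
  have der: "GDERIV F x :> gradient F x" and cont: "continuous_on UNIV F"
    if "continuously_differentiable F" for F :: "real ^ 'n \<Rightarrow> real" and x
    using that unfolding continuously_differentiable_def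
    by (auto intro!: GDERIV_gradient continuous_at_imp_continuous_on
        differentiable_imp_continuous_within)
  have cont_\<psi>: "continuous_on UNIV \<psi>"
    unfolding \<psi>_def by (intro continuous_on_mpvc_violation cont assms)
  \<comment> \<open>The same number serves as radius and as penalty weight: if every
    \<open>k\<close> failed, the exceptional points would converge to \<open>xstar\<close> while the
    weights tend to 0.\<close>
  have "\<exists>k. \<forall>y\<in>ball xstar (inverse (Suc k)). 0 < \<psi> y \<longrightarrow>
      \<not> (\<forall>\<^sub>F x in nhds y. \<psi> y \<le> \<psi> x + inverse (Suc k) * dist x y)"
  proof (rule ccontr)
    assume "\<not> ?thesis"
    then have "\<exists>y. y \<in> ball xstar (inverse (Suc k)) \<and> 0 < \<psi> y \<and>
        (\<forall>\<^sub>F x in nhds y. \<psi> y \<le> \<psi> x + inverse (Suc k) * dist x y)" for k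
      by blast
    then have "\<exists>Y. \<forall>k. Y k \<in> ball xstar (inverse (Suc k)) \<and> 0 < \<psi> (Y k) \<and>
        (\<forall>\<^sub>F x in nhds (Y k). \<psi> (Y k) \<le> \<psi> x + inverse (Suc k) * dist x (Y k))"
      by (intro choice allI)
    then obtain Y where Y: "\<And>k. Y k \<in> ball xstar (inverse (Suc k))" and pos: "\<And>k. 0 < \<psi> (Y k)"
      and calm: "\<And>k. \<forall>\<^sub>F x in nhds (Y k). \<psi> (Y k) \<le> \<psi> x + inverse (Suc k) * dist x (Y k)"
      by blast
    have "\<exists>lam mu etaG etaH.
        mpvc_approx_multipliers m p q g h G H (inverse (Suc k)) (Y k) lam mu etaG etaH" for k
      using pos[of k] calm[of k] unfolding \<psi>_def
      by (intro mpvc_approx_multipliers_exist der assms) auto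
    then obtain lam mu etaG etaH where "\<And>k. mpvc_approx_multipliers m p q g h G H
        (inverse (Suc k)) (Y k) (lam k) (mu k) (etaG k) (etaH k)"
      by metis
    moreover have "Y \<longlonglongrightarrow> xstar"
    proof (rule metric_tendsto_imp_tendsto[OF LIMSEQ_inverse_real_of_nat])
      show "\<forall>\<^sub>F k in sequentially. dist (Y k) xstar \<le> dist (inverse (real (Suc k))) 0"
        using Y by (intro always_eventually) (auto simp: dist_commute less_imp_le)
    qed
    ultimately show False
      using not_quasinormal_if_approx_multipliers[OF assms(2-6) LIMSEQ_inverse_real_of_nat] assms(7) by blast
  qed
  then obtain k where none: "\<And>y. y \<in> ball xstar (inverse (Suc k)) \<Longrightarrow> 0 < \<psi> y \<Longrightarrow>
      \<not> (\<forall>\<^sub>F x in nhds y. \<psi> y \<le> \<psi> x + inverse (Suc k) * dist x y)"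
    by blast
  define \<epsilon> where "\<epsilon> = inverse (real (Suc k))"
  have "\<epsilon> > 0" by (simp add: \<epsilon>_def)
  have "infdist x (mpvc_feasible m p q g h G H) \<le>
      2 / \<epsilon> * (l1_norm p (\<lambda>i. h i x) + l1_norm m (\<lambda>i. max 0 (g i x))
           + (\<Sum>i=1..q. dist_Delta (G i x, H i x)))" if "x \<in> cball xstar (\<epsilon> / 2 / 2)" for x
  proof -
    have "infdist x {x. \<psi> x = 0} \<le> 2 / \<epsilon> * \<psi> x"
    proof (rule error_bound_if_no_calm_point[OF cont_\<psi>])
      show "0 \<le> \<psi> x" for x by (simp add: \<psi>_def mpvc_violation_nonneg)
      show "\<psi> xstar = 0" using assms(6) zeros by blast
      show "x \<in> ball xstar (\<epsilon> / 2)" using that \<open>\<epsilon> > 0\<close> by simp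
    qed (use none \<open>\<epsilon> > 0\<close> in \<open>auto simp: \<epsilon>_def\<close>)
    also have "2 / \<epsilon> * \<psi> x \<le> 2 / \<epsilon> * (l1_norm p (\<lambda>i. h i x) + l1_norm m (\<lambda>i. max 0 (g i x))
           + (\<Sum>i=1..q. dist_Delta (G i x, H i x)))"
      unfolding \<psi>_def using \<open>\<epsilon> > 0\<close> by (intro mult_left_mono mpvc_violation_le) auto
    finally show ?thesis
      by (simp only: zeros)
  qed
  \<comment> \<open>With \<open>\<delta> = \<epsilon> / 2\<close> the closed ball of radius
    \<open>\<epsilon> / 4\<close> fits into the open ball of radius \<open>\<epsilon> / 2\<close> in
    which the abstract error bound holds.\<close>
  then show ?thesis
    using \<open>\<epsilon> > 0\<close> by (intro exI[of _ "\<epsilon> / 2"] exI[of _ "2 / \<epsilon>"] conjI ballI) auto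
qed

end
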